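(* Let $\alpha\in\mathbb{R}$, $\beta>-1$ and $f\in\mathcal{Y}_{\alpha,\beta}$. Then every limit function $\mathfrak{f}=\lim_{n\to\infty}f_{h_n}$ (with $h_n\to\infty$, where $f_h(z)=h^{-\alpha}f(h+h^{-\beta}z)$, convergence being locally uniform in $\mathbb{C}$ with respect to the spherical metric) belongs to the Yosida class $A_0=\mathcal{Y}_{0,0}$.
   Context: For $\alpha\in\mathbb{R}$ and $\beta>-1$, the class $\mathcal{Y}_{\alpha,\beta}$ consists of all transcendental meromorphic functions $f$ in $\mathbb{C}$ such that the family $(f_h)_{h\in\mathbb{C},|h|\ge 1}$ of functions $f_h(z)=h^{-\alpha}f(h+h^{-\beta}z)$ (for any, or just one, determination of $h^{-\alpha}$ and $h^{-\beta}$) is normal in $\mathbb{C}$, and no limit function $\lim_{n\to\infty}f_{h_n}$ with $h_n\to\infty$ is constant (the constant $\infty$ is also excluded). Convergence is always locally uniform convergence with respect to the spherical metric. The Yosida class $A_0$ is the set of transcendental meromorphic functions $f$ in $\mathbb{C}$ with bounded spherical derivative $f^\#=|f'|/(1+|f|^2)$ such that no limit function of translates $f(z+h_n)$, $h_n\to\infty$, is constant; it coincides with $\mathcal{Y}_{0,0}$. *)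

theory Defs
  imports "HOL-Complex_Analysis.Complex_Analysis"
begin

text \<open>
  The Riemann sphere is the unit sphere of \<^typ>\<open>complex \<times> real\<close>, whose Euclidean distance is
  the chordal form of the spherical metric (see \<open>dist_stereo\<close> below) and is uniformly
  equivalent to the geodesic distance. The north pole \<open>(0, 1)\<close> is the point at infinity.
\<close>

definition stereo :: "complex \<Rightarrow> complex \<times> real" where
  "stereo w = (of_real (2 / (1 + (norm w)\<^sup>2)) * w, ((norm w)\<^sup>2 - 1) / ((norm w)\<^sup>2 + 1))"

text \<open>
  A meromorphic function on the plane is represented by its normal form
  \<open>f nicely_meromorphic_on UNIV\<close>: continuous off its poles and with the dummy value 0 at its
  poles. The following map restores the value \<open>\<infinity>\<close> there.
\<close>

definition to_sphere :: "(complex \<Rightarrow> complex) \<Rightarrow> complex \<Rightarrow> complex \<times> real" where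
  "to_sphere f z = (if is_pole f z then (0, 1) else stereo (f z))"

text \<open>
  Limits are sphere-valued, so that the constant \<open>\<infinity>\<close> is a possible limit and is covered by
  \<open>F constant_on UNIV\<close>.
\<close>

definition spherical_limit :: "(nat \<Rightarrow> complex \<Rightarrow> complex) \<Rightarrow> (complex \<Rightarrow> complex \<times> real) \<Rightarrow> bool" where
  "spherical_limit s F \<longleftrightarrow>
     (\<forall>K. compact K \<longrightarrow> uniform_limit K (\<lambda>n. to_sphere (s n)) F sequentially)"

definition normal_family :: "(complex \<Rightarrow> complex) set \<Rightarrow> bool" where
  "normal_family \<F> \<longleftrightarrow>
     (\<forall>s. range s \<subseteq> \<F> \<longrightarrow> (\<exists>r F. strict_mono (r :: nat \<Rightarrow> nat) \<and> spherical_limit (s \<circ> r) F))"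

definition transcendental_meromorphic :: "(complex \<Rightarrow> complex) \<Rightarrow> bool" where
  "transcendental_meromorphic f \<longleftrightarrow> f nicely_meromorphic_on UNIV \<and>
     \<not> (\<exists>P Q. Q \<noteq> 0 \<and> (\<forall>z. poly Q z \<noteq> 0 \<longrightarrow> f z = poly P z / poly Q z))"

text \<open>
  \<open>p h\<close> is one of the values of \<open>h\<^sup>a\<close>, chosen separately for each \<open>h\<close>; no continuity in \<open>h\<close> is
  required (in general no continuous choice exists on \<open>\<bar>h\<bar> \<ge> 1\<close>).
\<close>

definition power_determination :: "real \<Rightarrow> (complex \<Rightarrow> complex) \<Rightarrow> bool" where
  "power_determination a p \<longleftrightarrow> (\<forall>h. h \<noteq> 0 \<longrightarrow> (\<exists>l. exp l = h \<and> p h = exp (of_real a * l)))"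

definition rescale ::
  "(complex \<Rightarrow> complex) \<Rightarrow> (complex \<Rightarrow> complex) \<Rightarrow> (complex \<Rightarrow> complex) \<Rightarrow> complex \<Rightarrow> complex \<Rightarrow> complex" where
  "rescale p q f h = (\<lambda>z. p h * f (h + q h * z))"

text \<open>
  Different determinations change \<open>f\<^sub>h(z)\<close> only to \<open>c f\<^sub>h(d z)\<close> with \<open>\<bar>c\<bar> = \<bar>d\<bar> = 1\<close>, so it
  does not matter which ones are used; the class asks for just one.
\<close>

definition Yosida_class :: "real \<Rightarrow> real \<Rightarrow> (complex \<Rightarrow> complex) set" where
  "Yosida_class \<alpha> \<beta> = {f. transcendental_meromorphic f \<and>
     (\<exists>p q. power_determination (- \<alpha>) p \<and> power_determination (- \<beta>) q \<and>
        normal_family {rescale p q f h | h. norm h \<ge> 1} \<and>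
        (\<forall>h F. filterlim h at_infinity sequentially \<and>
               spherical_limit (\<lambda>n. rescale p q f (h n)) F \<longrightarrow> \<not> F constant_on UNIV))}"

text \<open>
  At a pole \<open>f\<^sup>#\<close> is \<open>(1/f)\<^sup>#\<close>; the dummy value 0 of \<open>f\<close> and \<open>inverse 0 = 0\<close> give \<open>1/f\<close> its
  correct value there.
\<close>

definition spherical_deriv :: "(complex \<Rightarrow> complex) \<Rightarrow> complex \<Rightarrow> real" where
  "spherical_deriv f z =
     (if is_pole f z then norm (deriv (\<lambda>w. inverse (f w)) z)
      else norm (deriv f z) / (1 + (norm (f z))\<^sup>2))"

definition Yosida_A0 :: "(complex \<Rightarrow> complex) set" where
  "Yosida_A0 = {f. transcendental_meromorphic f \<and> bounded (range (spherical_deriv f)) \<and>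
     (\<forall>h F. filterlim h at_infinity sequentially \<and>
            spherical_limit (\<lambda>n z. f (z + h n)) F \<longrightarrow> \<not> F constant_on UNIV)}"

lemma norm_stereo: "norm (stereo w) = 1"
proof -
  define a where "a = (norm w)\<^sup>2"
  have a: "1 + a > 0" by (simp add: a_def add_pos_nonneg)
  have ww: "w \<bullet> w = a" by (simp add: a_def dot_square_norm)
  have st: "stereo w = ((2 / (1 + a)) *\<^sub>R w, (a - 1) / (a + 1))"
    by (simp add: stereo_def scaleR_conv_of_real a_def)
  have "stereo w \<bullet> stereo w = (2 / (1 + a))\<^sup>2 * a + ((a - 1) / (a + 1))\<^sup>2"
    unfolding st using ww by (simp add: power2_eq_square)
  also have "\<dots> = (4 * a + (a - 1)\<^sup>2) / (1 + a)\<^sup>2"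
    by (simp add: power_divide add_divide_distrib add.commute)
  also have "4 * a + (a - 1)\<^sup>2 = (1 + a)\<^sup>2"
    by (simp add: power2_eq_square algebra_simps)
  also have "(1 + a)\<^sup>2 / (1 + a)\<^sup>2 = 1"
    using a by simp
  finally show ?thesis
    by (simp add: norm_eq_sqrt_inner)
qed

lemma dist_stereo:
  "dist (stereo z) (stereo w) = 2 * dist z w / (sqrt (1 + (norm z)\<^sup>2) * sqrt (1 + (norm w)\<^sup>2))"
proof -
  define a b c where "a = (norm z)\<^sup>2" and "b = (norm w)\<^sup>2" and "c = z \<bullet> w"
  have pos: "1 + a > 0" "1 + b > 0" by (auto simp: a_def b_def add_pos_nonneg)
  have zz: "z \<bullet> z = a" "w \<bullet> w = b" by (auto simp: a_def b_def dot_square_norm)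
  have st: "stereo v = ((2 / (1 + (norm v)\<^sup>2)) *\<^sub>R v, ((norm v)\<^sup>2 - 1) / ((norm v)\<^sup>2 + 1))" for v
    by (simp add: stereo_def scaleR_conv_of_real)
  have "(dist (stereo z) (stereo w))\<^sup>2 = (norm (stereo z))\<^sup>2 + (norm (stereo w))\<^sup>2 - 2 * (stereo z \<bullet> stereo w)"
    by (simp add: dist_norm power2_norm_eq_inner inner_diff inner_commute)
  also have "stereo z \<bullet> stereo w = (4 * c + (a - 1) * (b - 1)) / ((1 + a) * (1 + b))"
    by (simp add: st a_def[symmetric] b_def[symmetric] c_def[symmetric] add_divide_distrib add.commute)
  also have "(norm (stereo z))\<^sup>2 + (norm (stereo w))\<^sup>2 - 2 * ((4 * c + (a - 1) * (b - 1)) / ((1 + a) * (1 + b)))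
     = 4 * (a + b - 2 * c) / ((1 + a) * (1 + b))"
  proof -
    have *: "1 + 1 - 2 * (x / y) = t / y" if "2 * y - 2 * x = t" "y > 0" for x y t :: real
      using that by (simp add: field_simps)
    have **: "2 * ((1 + a) * (1 + b)) - 2 * (4 * c + (a - 1) * (b - 1)) = 4 * (a + b - 2 * c)"
      by (simp add: algebra_simps)
    show ?thesis
      unfolding norm_stereo power_one by (rule *[OF **]) (use pos in simp)
  qed
  also have "a + b - 2 * c = (dist z w)\<^sup>2"
    by (simp add: dist_norm power2_norm_eq_inner inner_diff inner_commute zz c_def)
  also have "4 * (dist z w)\<^sup>2 / ((1 + a) * (1 + b)) = (2 * dist z w / (sqrt (1 + a) * sqrt (1 + b)))\<^sup>2"
    using pos by (simp add: power_divide power_mult_distrib)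
  finally show ?thesis
    using pos by (simp add: a_def b_def)
qed

lemma dist_stereo_infinity: "dist (stereo z) (0, 1) = 2 / sqrt (1 + (norm z)\<^sup>2)"
proof -
  define a where "a = (norm z)\<^sup>2"
  have pos: "1 + a > 0" by (auto simp: a_def add_pos_nonneg)
  have "(dist (stereo z) (0, 1))\<^sup>2 = (norm (stereo z))\<^sup>2 + 1 - 2 * (stereo z \<bullet> (0, 1))"
    by (simp add: dist_norm power2_norm_eq_inner inner_diff inner_commute)
  also have "\<dots> = (2 / sqrt (1 + a))\<^sup>2"
    unfolding norm_stereo using pos by (simp add: stereo_def power_divide a_def[symmetric] field_simps)
  finally show ?thesis
    using pos by (simp add: a_def)
qed

end

theory Submission imports Defs begin

text \<open>
  Let \<open>F\<close> be the limit of \<open>f\<^sub>h\<close> along a sequence \<open>h n\<close> tending to infinity. A locally uniform limit of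
  meromorphic functions is holomorphic as a map into the sphere, so a nonconstant limit is
  meromorphic (\<open>nonconstant_sphere_hol_is_meromorphic\<close>), and \<open>F = to_sphere g\<close>.
  
  The key observation is that the limit functions are stable under translation. The function
  \<open>f\<^sub>h(z + k)\<close> is, up to factors of modulus close to 1, equal to \<open>f\<^sub>h\<^sub>'(z)\<close> with
  \<open>h' = h + h\<^sup>-\<^sup>\<beta> k\<close>. Indeed \<open>h' / h\<close> tends to 1, because \<open>\<beta> > -1\<close>. Choosing \<open>h\<close> far out for each member
  of a given sequence \<open>k m\<close>, the translates \<open>g(z + k m)\<close> become asymptotic to rescalings of \<open>f\<close>
  (\<open>translates_of_limit\<close>). The two properties of the class therefore carry over
  (\<open>Yosida_class_rescalings\<close>): every sequence of translates of \<open>g\<close> has a convergent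
  subsequence, and its limits are not constant.
  
  This single property of \<open>g\<close> gives everything else (\<open>translates_imp_Yosida\<close>). It contains
  normality and nonconstancy of the limits as required for \<open>\<alpha> = \<beta> = 0\<close>. It makes \<open>g\<close> uniformly
  continuous as a map into the sphere, so Cauchy's estimate in the two charts bounds the
  spherical derivative. Finally \<open>g\<close> is not rational, since translates of a rational
  function converge to a constant.
\<close>

section \<open>Charts of the Riemann sphere\<close>

text \<open>
  The chart centred at the south pole, inverse to \<open>stereo\<close>. Division by zero gives it the value
  0 at the north pole, which is also the dummy value of a nicely meromorphic function at a
  pole; hence \<open>chart_to_sphere\<close> holds without exception.
\<close>
definition chart :: "complex \<times> real \<Rightarrow> complex" where
  "chart x = fst x / of_real (1 - snd x)"

text \<open>
  The map \<open>w \<mapsto> 1 / w\<close> of the sphere, so that \<open>chart (flip x)\<close> is the coordinate near infinity.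
\<close>
definition flip :: "complex \<times> real \<Rightarrow> complex \<times> real" where
  "flip x = (cnj (fst x), - snd x)"

text \<open>
  For \<open>norm c = 1\<close> this is the rotation of the sphere induced by \<open>w \<mapsto> c * w\<close>.
\<close>
definition rot :: "complex \<Rightarrow> complex \<times> real \<Rightarrow> complex \<times> real" where
  "rot c x = (c * fst x, snd x)"

lemma flip_flip [simp]: "flip (flip x) = x"
  by (simp add: flip_def)

lemma norm_flip [simp]: "norm (flip x) = norm x"
  by (simp add: flip_def norm_prod_def)

lemma dist_flip [simp]: "dist (flip x) (flip y) = dist x y"
  by (simp add: flip_def dist_prod_def dist_norm power2_commute flip: complex_cnj_diff)

lemma dist_rot: "norm c = 1 \<Longrightarrow> dist (rot c x) (rot c y) = dist x y"
  by (simp add: rot_def dist_prod_def dist_norm norm_mult flip: right_diff_distrib)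

lemma sphere_eq:
  fixes x :: "complex \<times> real"
  assumes "norm x = 1"
  shows "(norm (fst x))\<^sup>2 = (1 - snd x) * (1 + snd x)"
proof -
  have "(norm (fst x))\<^sup>2 + (snd x)\<^sup>2 = 1"
    using assms by (simp add: norm_prod_def)
  then show ?thesis by (simp add: algebra_simps power2_eq_square)
qed

lemma sphere_snd:
  fixes x :: "complex \<times> real"
  assumes "norm x = 1"
  shows "- 1 \<le> snd x" "snd x \<le> 1"
proof -
  have "\<bar>snd x\<bar> \<le> norm x" using norm_snd_le[of "snd x" "fst x"] by simp
  with assms show "- 1 \<le> snd x" "snd x \<le> 1" by auto
qed

lemma north_iff:
  fixes x :: "complex \<times> real"
  assumes "norm x = 1"
  shows "x = (0, 1) \<longleftrightarrow> snd x = 1"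
  using sphere_eq[OF assms] by (auto simp: prod_eq_iff)

lemma snd_less_1:
  fixes x :: "complex \<times> real"
  assumes "norm x = 1" "x \<noteq> (0, 1)"
  shows "snd x < 1"
  using north_iff[OF assms(1)] sphere_snd(2)[OF assms(1)] assms(2) by linarith

lemma chart_north [simp]: "chart (0, 1) = 0"
  by (simp add: chart_def)

lemma chart_stereo [simp]: "chart (stereo w) = w"
proof -
  define a where "a = (norm w)\<^sup>2"
  have a: "1 + a > 0" by (simp add: a_def add_pos_nonneg)
  have e: "1 - (a - 1) / (a + 1) = 2 / (1 + a)" using a by (simp add: field_simps)
  have "2 / (1 + a) \<noteq> 0" using a by simp
  then have "(of_real (2 / (1 + a)) :: complex) \<noteq> 0" by (metis of_real_eq_0_iff)
  then show ?thesis
    by (simp add: chart_def stereo_def a_def[symmetric] e del: of_real_divide)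
qed

lemma stereo_neq_north [simp]: "stereo w \<noteq> (0, 1)"
proof -
  have "2 / sqrt (1 + (norm w)\<^sup>2) \<noteq> 0"
    by (smt (verit) divide_eq_0_iff real_sqrt_eq_zero_cancel_iff zero_le_power2)
  then show ?thesis using dist_stereo_infinity[of w] by auto
qed

lemma norm_chart_sq:
  assumes "norm x = 1" "x \<noteq> (0, 1)"
  shows "(norm (chart x))\<^sup>2 = (1 + snd x) / (1 - snd x)"
proof -
  have lt: "snd x < 1" using assms by (rule snd_less_1)
  then have "norm (chart x) = norm (fst x) / (1 - snd x)"
    unfolding chart_def norm_divide norm_of_real by simp
  then have "(norm (chart x))\<^sup>2 = (1 - snd x) * (1 + snd x) / (1 - snd x)\<^sup>2"
    by (simp only: power_divide sphere_eq[OF assms(1)])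
  then show ?thesis
    using lt by (simp add: power2_eq_square)
qed

lemma stereo_chart:
  assumes "norm x = 1" "x \<noteq> (0, 1)"
  shows "stereo (chart x) = x"
proof -
  have lt: "snd x < 1" using assms by (rule snd_less_1)
  have s: "1 + (1 + snd x) / (1 - snd x) = 2 / (1 - snd x)" 
          "(1 + snd x) / (1 - snd x) - 1 = 2 * snd x / (1 - snd x)"
          "(1 + snd x) / (1 - snd x) + 1 = 2 / (1 - snd x)"
    using lt by (simp_all add: field_simps)
  have ne: "(complex_of_real (1 - snd x)) \<noteq> 0" using lt by (metis of_real_eq_0_iff less_irrefl diff_gt_0_iff_gt)
  have "stereo (chart x) = (of_real (1 - snd x) * chart x, snd x)"
    unfolding stereo_def norm_chart_sq[OF assms] s using lt by simp
  also have "of_real (1 - snd x) * chart x = fst x"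
    using ne by (simp add: chart_def)
  finally show ?thesis by simp
qed

text \<open>
  The convention \<open>inverse 0 = 0\<close> makes this hold at both poles too.
\<close>
lemma chart_flip:
  assumes "norm x = 1"
  shows "chart x = inverse (chart (flip x))"
proof (cases "snd x = 1 \<or> snd x = -1")
  case True
  then have "fst x = 0" using sphere_eq[OF assms] by auto
  then show ?thesis by (simp add: chart_def flip_def)
next
  case False
  then have ne: "complex_of_real (1 - snd x) \<noteq> 0" "complex_of_real (1 + snd x) \<noteq> 0"
    using of_real_eq_0_iff[of "1 + snd x"] of_real_eq_0_iff[of "1 - snd x"] by fastforce+
  have eq: "fst x * cnj (fst x) = of_real (1 - snd x) * of_real (1 + snd x)"
    by (metis complex_norm_square of_real_mult sphere_eq[OF assms])
  then have "cnj (fst x) \<noteq> 0" using ne by auto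
  then have "fst x / of_real (1 - snd x) = of_real (1 + snd x) / cnj (fst x)"
    using eq ne by (subst frac_eq_eq) (simp_all add: mult.commute)
  then show ?thesis by (simp add: chart_def flip_def)
qed

text \<open>
  Away from the north pole, uniform convergence on the sphere therefore passes to uniform
  convergence of complex functions, to which the theorem of Weierstrass applies.
\<close>
lemma uniformly_continuous_on_chart:
  assumes "c < 1"
  shows "uniformly_continuous_on {x. norm x = 1 \<and> snd x \<le> c} chart"
proof (rule compact_uniformly_continuous)
  have "{x :: complex \<times> real. norm x = 1 \<and> snd x \<le> c} = sphere 0 1 \<inter> {x. snd x \<le> c}"
    by auto
  moreover have "closed {x :: complex \<times> real. snd x \<le> c}"
    by (intro closed_Collect_le continuous_intros)
  ultimately show "compact {x :: complex \<times> real. norm x = 1 \<and> snd x \<le> c}"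
    by (simp add: compact_Int_closed)
  have "complex_of_real (1 - snd x) \<noteq> 0" if "snd x \<le> c" for x :: "complex \<times> real"
    using that assms of_real_eq_0_iff[of "1 - snd x"] by fastforce
  then show "continuous_on {x. norm x = 1 \<and> snd x \<le> c} chart"
    unfolding chart_def by (intro continuous_intros) auto
qed

section \<open>Holomorphic maps into the sphere\<close>

text \<open>
  Holomorphy of a sphere-valued map is tested in the two charts: \<open>sphere_hol\<close> applies
  \<open>hol_off_north\<close> to the map itself and to its composition with \<open>flip\<close>. Unlike meromorphy
  this notion includes the constant \<open>\<infinity>\<close>, and it is closed under locally uniform limits.
\<close>
definition hol_off_north :: "(complex \<Rightarrow> complex \<times> real) \<Rightarrow> bool" where
  "hol_off_north G \<longleftrightarrow> continuous_on UNIV G \<and> (\<forall>z. norm (G z) = 1) \<and>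
     (\<forall>z. G z \<noteq> (0, 1) \<longrightarrow> (\<lambda>w. chart (G w)) analytic_on {z})"

definition sphere_hol :: "(complex \<Rightarrow> complex \<times> real) \<Rightarrow> bool" where
  "sphere_hol G \<longleftrightarrow> hol_off_north G \<and> hol_off_north (\<lambda>z. flip (G z))"

lemma to_sphere_pole_iff [simp]: "to_sphere f z = (0, 1) \<longleftrightarrow> is_pole f z"
  by (simp add: to_sphere_def)

lemma norm_to_sphere [simp]: "norm (to_sphere f z) = 1"
  using norm_stereo[of "f z"] by (auto simp: to_sphere_def norm_prod_def)

lemma chart_to_sphere:
  assumes "f nicely_meromorphic_on UNIV"
  shows "chart (to_sphere f z) = f z"
  using is_pole_zero_at_nicely_mero[OF assms] by (simp add: to_sphere_def)

lemma chart_flip_to_sphere: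
  assumes "f nicely_meromorphic_on UNIV"
  shows "chart (flip (to_sphere f z)) = inverse (f z)"
  using chart_flip[of "flip (to_sphere f z)"] chart_to_sphere[OF assms] by simp

lemma isCont_stereo: "isCont stereo w"
proof -
  have n: "1 + (norm (v :: complex))\<^sup>2 \<noteq> 0" "(norm v)\<^sup>2 + 1 \<noteq> 0" for v 
    by (smt (verit) zero_le_power2)+
  have "continuous_on UNIV stereo"
    unfolding stereo_def by (intro continuous_intros) (simp_all add: n)
  then show ?thesis by (simp add: continuous_on_eq_continuous_at)
qed

lemma stereo_at_infinity: "(stereo \<longlongrightarrow> (0, 1)) at_infinity"
proof -
  have lim: "((\<lambda>w :: complex. 2 * inverse (norm w)) \<longlongrightarrow> 0) at_infinity"
    by (intro tendsto_mult_right_zero tendsto_inverse_0_at_top filterlim_norm_at_top)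
  have "dist (stereo w) (0, 1) \<le> 2 * inverse (norm w)" if "w \<noteq> 0" for w
  proof -
    have "norm w \<le> sqrt (1 + (norm w)\<^sup>2)"
      by (rule real_le_rsqrt) simp
    then have "2 / sqrt (1 + (norm w)\<^sup>2) \<le> 2 / norm w"
      using that by (intro divide_left_mono mult_pos_pos) (auto simp: add_pos_nonneg)
    then show ?thesis by (simp add: dist_stereo_infinity divide_inverse)
  qed
  then have "\<forall>\<^sub>F w in at_infinity. norm (dist (stereo w) (0, 1)) \<le> 2 * inverse (norm w)"
    using eventually_not_equal_at_infinity[of 0] by (auto elim: eventually_mono)
  then have "((\<lambda>w. dist (stereo w) (0, 1)) \<longlongrightarrow> 0) at_infinity"
    by (rule Lim_null_comparison[OF _ lim])
  then show ?thesis by (simp only: tendsto_dist_iff[symmetric])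
qed

lemma isCont_to_sphere:
  assumes f: "f nicely_meromorphic_on UNIV"
  shows "isCont (to_sphere f) z"
proof (cases "is_pole f z")
  case True
  have "((\<lambda>w. stereo (f w)) \<longlongrightarrow> (0, 1)) (at z)"
    using True filterlim_compose[OF stereo_at_infinity] by (simp add: is_pole_def)
  moreover have "eventually (\<lambda>w. stereo (f w) = to_sphere f w) (at z)"
  proof -
    have "isolated_singularity_at f z"
      using f meromorphic_on_subset[of f UNIV "{z}"]
      by (simp add: nicely_meromorphic_on_def meromorphic_on_isolated_singularity)
    then have "eventually (\<lambda>w. \<not> is_pole f w) (at z)" by (rule eventually_not_pole)
    then show ?thesis by eventually_elim (simp add: to_sphere_def)
  qed
  ultimately have "(to_sphere f \<longlongrightarrow> (0, 1)) (at z)"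
    by (rule Lim_transform_eventually)
  then show ?thesis using True by (simp add: isCont_def to_sphere_def)
next
  case False
  then have an: "f analytic_on {z}" using f nicely_meromorphic_on_imp_analytic_at by blast
  then obtain A where A: "open A" "z \<in> A" "f holomorphic_on A" by (auto simp: analytic_at)
  have "eventually (\<lambda>w. to_sphere f w = stereo (f w)) (nhds z)"
    using eventually_nhds_in_open[OF A(1,2)]
    by eventually_elim (use A not_is_pole_holomorphic in \<open>auto simp: to_sphere_def\<close>)
  then have "isCont (to_sphere f) z \<longleftrightarrow> isCont (\<lambda>w. stereo (f w)) z"
    by (rule isCont_cong)
  then show ?thesis
    using isCont_o2[OF analytic_at_imp_isCont[OF an] isCont_stereo] by simp
qed

lemma sphere_hol_to_sphere:
  assumes f: "f nicely_meromorphic_on UNIV"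
  shows "sphere_hol (to_sphere f)"
proof -
  have cont: "continuous_on UNIV (to_sphere f)"
    using isCont_to_sphere[OF f] by (simp add: continuous_on_eq_continuous_at)
  then have cont': "continuous_on UNIV (\<lambda>z. flip (to_sphere f z))"
    unfolding flip_def by (intro continuous_intros)
  have "f analytic_on {z}" if "to_sphere f z \<noteq> (0, 1)" for z
    using that f nicely_meromorphic_on_imp_analytic_at by auto
  moreover have "(\<lambda>w. inverse (f w)) analytic_on {z}" if "flip (to_sphere f z) \<noteq> (0, 1)" for z
  proof (cases "is_pole f z")
    case True
    then have "\<not> is_pole (\<lambda>w. inverse (f w)) z"
      using pole_is_not_zero by (auto simp: is_pole_inverse_iff)
    then show ?thesis
      using nicely_meromorphic_on_imp_analytic_at[OF nicely_meromorphic_on_inverse[OF f]] by auto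
  next
    case False
    then have "f z \<noteq> 0" using that by (auto simp: to_sphere_def flip_def stereo_def)
    then show ?thesis
      using False f nicely_meromorphic_on_imp_analytic_at by (intro analytic_on_inverse) auto
  qed
  ultimately show ?thesis
    using cont cont' f
    by (simp add: sphere_hol_def hol_off_north_def chart_to_sphere chart_flip_to_sphere)
qed

text \<open>
  Where the limit avoids the north pole, it stays below some latitude \<open>b < 1\<close> on a small disc,
  and so do the approximating maps eventually. There \<open>chart\<close> is uniformly continuous, and
  uniform limits of holomorphic functions are holomorphic.
\<close>
lemma hol_off_north_limit:
  assumes hol: "eventually (\<lambda>n. hol_off_north (s n)) sequentially"
    and lim: "\<And>K. compact K \<Longrightarrow> uniform_limit K s G sequentially"
  shows "hol_off_north G"
proof -
  have ptw: "(\<lambda>n. s n z) \<longlonglongrightarrow> G z" for z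
    using tendsto_uniform_limitI[OF lim[of "{z}"]] by simp
  have "continuous_on (cball z 1) G" for z
    using hol by (intro uniform_limit_theorem[OF _ lim])
      (auto simp: hol_off_north_def elim!: eventually_mono intro: continuous_on_subset)
  then have cont: "continuous_on UNIV G"
    by (metis centre_in_ball continuous_on_eq_continuous_at continuous_on_interior
        interior_cball zero_less_one open_UNIV)
  have norm: "norm (G z) = 1" for z
  proof (rule tendsto_unique[OF _ tendsto_norm[OF ptw]])
    show "(\<lambda>n. norm (s n z)) \<longlonglongrightarrow> 1"
      using hol by (intro tendsto_eventually) (auto simp: hol_off_north_def elim!: eventually_mono)
  qed simp
  have "(\<lambda>w. chart (G w)) analytic_on {z}" if "G z \<noteq> (0, 1)" for z
  proof -
    have "snd (G z) < 1" using snd_less_1[OF norm that] .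
    \<comment> \<open>The limit stays below height \<open>a\<close> near \<open>z\<close>, the approximating maps below \<open>b\<close>; the gap
      absorbs the error of the approximation.\<close>
    then obtain a where a: "snd (G z) < a" "a < 1" using dense by blast
    obtain b where b: "a < b" "b < 1" using dense a by blast
    have "open ((\<lambda>w. snd (G w)) -` {..<a})"
      by (intro open_vimage continuous_on_snd cont) auto
    then obtain r where r: "r > 0" "cball z r \<subseteq> (\<lambda>w. snd (G w)) -` {..<a}"
      using a open_contains_cball by (metis lessThan_iff vimage_eq)
    let ?B = "{x :: complex \<times> real. norm x = 1 \<and> snd x \<le> b}"
    have near: "eventually (\<lambda>n. \<forall>w\<in>cball z r. dist (s n w) (G w) < b - a) sequentially"
      using lim[of "cball z r"] b by (intro uniform_limitD) auto
    have B: "eventually (\<lambda>n. \<forall>w\<in>cball z r. s n w \<in> ?B) sequentially"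
      using near hol
    proof eventually_elim
      case (elim n)
      show ?case
      proof
        fix w assume w: "w \<in> cball z r"
        have "\<bar>snd (s n w) - snd (G w)\<bar> \<le> dist (s n w) (G w)"
          by (metis dist_real_def dist_snd_le)
        moreover have "snd (G w) < a" using r w by auto
        ultimately show "s n w \<in> ?B"
          using elim w by (auto simp: hol_off_north_def intro: less_imp_le dest!: bspec[of _ _ w])
      qed
    qed
    have closed: "closed ?B"
    proof -
      have "?B = sphere 0 1 \<inter> {x. snd x \<le> b}" by auto
      moreover have "closed {x :: complex \<times> real. snd x \<le> b}"
        by (intro closed_Collect_le continuous_intros)
      ultimately show ?thesis by (simp add: closed_Int)
    qed
    have ul: "uniform_limit (cball z r) (\<lambda>n w. chart (s n w)) (\<lambda>w. chart (G w)) sequentially"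
      by (rule uniform_limit_compose_uniformly_continuous_on
          [OF lim uniformly_continuous_on_chart[OF b(2)] B closed]) simp
    have "eventually (\<lambda>n. (\<lambda>w. chart (s n w)) holomorphic_on cball z r) sequentially"
      using B hol
    proof eventually_elim
      case (elim n)
      have "(\<lambda>w. chart (s n w)) analytic_on {w}" if "w \<in> cball z r" for w
        using elim that b by (force simp: hol_off_north_def)
      then have "(\<lambda>w. chart (s n w)) analytic_on cball z r"
        using analytic_on_analytic_at by blast
      then show ?case by (rule analytic_imp_holomorphic)
    qed
    then have "eventually (\<lambda>n. continuous_on (cball z r) (\<lambda>w. chart (s n w)) \<and>
        (\<lambda>w. chart (s n w)) holomorphic_on ball z r) sequentially"
      by eventually_elim (meson ball_subset_cball holomorphic_on_imp_continuous_on holomorphic_on_subset)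
    then have "(\<lambda>w. chart (G w)) holomorphic_on ball z r"
      by (rule holomorphic_uniform_limit[OF _ ul]) auto
    then show ?thesis unfolding analytic_at using r(1) open_ball centre_in_ball by blast
  qed
  then show ?thesis using cont norm by (simp add: hol_off_north_def)
qed

lemma sphere_hol_limit:
  assumes hol: "eventually (\<lambda>n. s n nicely_meromorphic_on UNIV) sequentially"
    and lim: "spherical_limit s G"
  shows "sphere_hol G"
proof -
  have "eventually (\<lambda>n. sphere_hol (to_sphere (s n))) sequentially"
    using hol by eventually_elim (rule sphere_hol_to_sphere)
  then have ev: "eventually (\<lambda>n. hol_off_north (to_sphere (s n))) sequentially"
      "eventually (\<lambda>n. hol_off_north (\<lambda>z. flip (to_sphere (s n) z))) sequentially"
    by (auto simp: sphere_hol_def elim: eventually_mono)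
  have lim1: "uniform_limit K (\<lambda>n. to_sphere (s n)) G sequentially" if "compact K" for K
    using lim that by (simp add: spherical_limit_def)
  have lim2: "uniform_limit K (\<lambda>n z. flip (to_sphere (s n) z)) (\<lambda>z. flip (G z)) sequentially"
    if "compact K" for K
    using lim1[OF that] by (simp add: uniform_limit_iff)
  show ?thesis
    unfolding sphere_hol_def
    using hol_off_north_limit[OF ev(1) lim1] hol_off_north_limit[OF ev(2) lim2] by simp
qed

text \<open>
  A point where \<open>G\<close> takes the value \<open>\<infinity>\<close> is a zero of the holomorphic function \<open>k = 1 / g\<close>. If the
  zero is isolated, it gives a pole of \<open>g\<close>. Otherwise \<open>G\<close> is \<open>\<infinity>\<close> near that point. The set \<open>A\<close> of
  points of the second kind is open and closed, so it is empty or \<open>G\<close> is the constant \<open>\<infinity>\<close>.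
\<close>
lemma nonconstant_sphere_hol_is_meromorphic:
  assumes hol: "sphere_hol G" and nc: "\<not> G constant_on UNIV"
  defines "g \<equiv> \<lambda>z. chart (G z)"
  shows "g nicely_meromorphic_on UNIV" "to_sphere g = G"
proof -
  define k where "k = (\<lambda>z. chart (flip (G z)))"
  have norm: "norm (G z) = 1" for z using hol by (simp add: sphere_hol_def hol_off_north_def)
  have gk: "g = (\<lambda>z. inverse (k z))"
    unfolding g_def k_def using chart_flip[OF norm] by blast
  have g_an: "g analytic_on {z}" if "G z \<noteq> (0, 1)" for z
    using hol that by (simp add: sphere_hol_def hol_off_north_def g_def)
  have k_an: "k analytic_on {z}" if "G z = (0, 1)" for z
    using hol that by (simp add: sphere_hol_def hol_off_north_def k_def flip_def)
  have k0: "k z = 0" if "G z = (0, 1)" for z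
    using that by (simp add: k_def flip_def chart_def)
  have contG: "isCont G z" for z
    using hol by (auto simp: sphere_hol_def hol_off_north_def continuous_on_eq_continuous_at)
  define A where "A = {z. eventually (\<lambda>w. G w = (0, 1)) (nhds z)}"
  have isolated: "isolated_zero k z" if "G z = (0, 1)" "z \<notin> A" for z
  proof (rule ccontr)
    assume "\<not> isolated_zero k z"
    then have "eventually (\<lambda>w. k w = 0) (at z)"
      using non_isolated_zero_imp_eventually_zero[OF k_an] that k0 by blast
    then have "eventually (\<lambda>w. k w = 0) (nhds z)"
      unfolding eventually_at_filter by eventually_elim (use k0 that in blast)
    \<comment> \<open>The function \<open>k\<close> also vanishes by convention at the south pole, which is excluded here.\<close>
    moreover have "eventually (\<lambda>w. snd (G w) > 0) (nhds z)"
    proof -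
      have "isCont (\<lambda>w. snd (G w)) z" by (intro isCont_snd contG)
      then have "((\<lambda>w. snd (G w)) \<longlongrightarrow> snd (G z)) (nhds z)"
        by (simp only: isCont_def tendsto_at_iff_tendsto_nhds[of "\<lambda>w. snd (G w)" z])
      then show ?thesis by (rule order_tendstoD) (simp add: that)
    qed
    ultimately have "eventually (\<lambda>w. G w = (0, 1)) (nhds z)"
    proof eventually_elim
      case (elim w)
      then have "complex_of_real (1 + snd (G w)) \<noteq> 0"
        using of_real_eq_0_iff[of "1 + snd (G w)"] by fastforce
      then have "fst (G w) = 0" using elim by (simp add: k_def chart_def flip_def)
      then show ?case using sphere_eq[OF norm[of w]] elim by (auto simp: prod_eq_iff)
    qed
    then show False using that by (simp add: A_def)
  qed
  have "open A"
    unfolding A_def by (subst open_subopen) (auto simp: eventually_nhds)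
  moreover have "open (- A)"
  proof -
    have "eventually (\<lambda>w. w \<in> - A) (nhds z)" if "z \<notin> A" for z
    proof -
      have "eventually (\<lambda>w. G w \<noteq> (0, 1)) (at z)"
      proof (cases "G z = (0, 1)")
        case True
        then have "eventually (\<lambda>w. k w \<noteq> 0) (at z)"
          using isolated that by (simp add: isolated_zero_def)
        then show ?thesis by eventually_elim (use k0 in blast)
      next
        case False
        then show ?thesis using contG[of z] tendsto_imp_eventually_ne isCont_def by metis
      qed
      then have "eventually (\<lambda>w. w \<noteq> z \<longrightarrow> w \<in> - A) (nhds z)"
        unfolding eventually_at_filter
        by eventually_elim (auto simp: A_def dest: eventually_nhds_x_imp_x)
      then show ?thesis by eventually_elim (use that in auto)
    qed
    then show ?thesis by (subst open_subopen) (force simp: eventually_nhds)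
  qed
  ultimately have "A = {} \<or> A = UNIV" using clopen by (metis closed_def)
  moreover have "A \<noteq> UNIV"
  proof
    assume "A = UNIV"
    then have "G z = (0, 1)" for z unfolding A_def using eventually_nhds_x_imp_x by blast
    then show False using nc by (auto simp: constant_on_def)
  qed
  ultimately have pole: "is_pole g z" if "G z = (0, 1)" for z
    using isolated[of z] that by (simp add: gk is_pole_inverse_iff)
  have "g meromorphic_on {z}" for z
  proof (cases "G z = (0, 1)")
    case True
    then show ?thesis
      unfolding gk using k_an by (intro meromorphic_on_inverse analytic_on_imp_meromorphic_on)
  qed (use g_an analytic_on_imp_meromorphic_on in blast)
  then have "g meromorphic_on UNIV" by (subst meromorphic_on_meromorphic_at) blast
  moreover have "is_pole g z \<and> g z = 0 \<or> g \<midarrow>z\<rightarrow> g z" for z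
  proof (cases "G z = (0, 1)")
    case True
    then show ?thesis using pole by (simp add: g_def)
  next
    case False
    then show ?thesis using g_an analytic_at_imp_isCont isCont_def by blast
  qed
  ultimately show "g nicely_meromorphic_on UNIV" by (simp add: nicely_meromorphic_on_def)
  show "to_sphere g = G"
  proof
    fix z
    show "to_sphere g z = G z"
    proof (cases "G z = (0, 1)")
      case True
      then show ?thesis using pole by (simp add: to_sphere_def)
    next
      case False
      then have "\<not> is_pole g z" using g_an analytic_at_imp_no_pole by blast
      then show ?thesis using stereo_chart[OF norm False] by (simp add: to_sphere_def g_def)
    qed
  qed
qed

section \<open>Affine changes of variable and spherical limits\<close>

lemma is_pole_affine:
  fixes a b d :: complex
  assumes "a \<noteq> 0" "d \<noteq> 0"
  shows "is_pole (\<lambda>z. a * f (b + d * z)) z \<longleftrightarrow> is_pole f (b + d * z)"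
proof -
  have "is_pole (\<lambda>z. f (b + d * z)) z" if "is_pole f (b + d * z)"
    by (rule is_pole_compose[OF that])
      (use assms in \<open>auto intro!: tendsto_eq_intros simp: eventually_at_filter\<close>)
  moreover have "is_pole f (b + d * z)" if pole: "is_pole (\<lambda>z. f (b + d * z)) z"
  proof -
    have "is_pole (\<lambda>w. f (b + d * ((w - b) / d))) (b + d * z)"
      by (rule is_pole_compose[OF pole])
        (use assms in \<open>auto intro!: tendsto_eq_intros simp: eventually_at_filter field_simps\<close>)
    then show ?thesis using assms by simp
  qed
  ultimately show ?thesis using assms(1) by auto
qed

lemma nicely_meromorphic_affine:
  assumes f: "f nicely_meromorphic_on UNIV" and "a \<noteq> 0" "d \<noteq> 0"
  shows "(\<lambda>z. a * f (b + d * z)) nicely_meromorphic_on UNIV"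
proof -
  have "(\<lambda>z. f (b + d * z)) meromorphic_on UNIV"
  proof (rule meromorphic_on_compose[where g = f and A = UNIV])
    show "f meromorphic_on UNIV" using f by (simp add: nicely_meromorphic_on_def)
    show "(\<lambda>z. b + d * z) analytic_on UNIV" by (intro analytic_intros)
  qed simp
  then have "(\<lambda>z. a * f (b + d * z)) meromorphic_on UNIV"
    by (intro meromorphic_intros)
  moreover have "is_pole (\<lambda>z. a * f (b + d * z)) z \<and> a * f (b + d * z) = 0
      \<or> (\<lambda>z. a * f (b + d * z)) \<midarrow>z\<rightarrow> a * f (b + d * z)" for z
  proof (cases "is_pole f (b + d * z)")
    case True
    then show ?thesis
      using is_pole_affine[OF assms(2,3)] True is_pole_zero_at_nicely_mero[OF f True] by simp
  next
    case False
    then have "isCont f (b + d * z)"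
      using f by (meson UNIV_I analytic_at_imp_isCont nicely_meromorphic_on_imp_analytic_at)
    moreover have "isCont (\<lambda>z. b + d * z) z" by (intro continuous_intros)
    ultimately have "isCont (\<lambda>z. f (b + d * z)) z" by (rule isCont_o2[rotated])
    then have "isCont (\<lambda>z. a * f (b + d * z)) z" by (intro continuous_intros)
    then show ?thesis by (simp add: isCont_def)
  qed
  ultimately show ?thesis by (simp add: nicely_meromorphic_on_def)
qed

lemma to_sphere_affine:
  assumes "d \<noteq> 0"
  shows "to_sphere (\<lambda>z. f (b + d * z)) z = to_sphere f (b + d * z)"
  using is_pole_affine[of 1 d f b z] assms by (simp add: to_sphere_def)

lemma rot_stereo:
  assumes "norm c = 1"
  shows "rot c (stereo w) = stereo (c * w)"
  using assms by (simp add: rot_def stereo_def norm_mult mult_ac)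

text \<open>
  A factor \<open>b\<close> of modulus close to 1 moves points of the sphere almost like a rotation, with an
  error that does not depend on the point.
\<close>
lemma dist_to_sphere_cmult:
  assumes "norm c = 1" "b \<noteq> 0"
  shows "dist (to_sphere (\<lambda>z. b * u z) z) (rot c (to_sphere u z)) \<le> 2 * norm (b - c)"
proof (cases "is_pole u z")
  case True
  then show ?thesis using assms by (simp add: to_sphere_def rot_def)
next
  case False
  let ?w = "u z"
  have le1: "1 \<le> sqrt (1 + (norm (b * ?w))\<^sup>2)" by simp
  have le2: "norm ?w \<le> sqrt (1 + (norm (c * ?w))\<^sup>2)"
    using assms by (intro real_le_rsqrt) (simp add: norm_mult)
  have pos: "0 < sqrt (1 + (norm (c * ?w))\<^sup>2)" by (simp add: add_pos_nonneg)
  have "1 * norm ?w \<le> sqrt (1 + (norm (b * ?w))\<^sup>2) * sqrt (1 + (norm (c * ?w))\<^sup>2)"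
    using le1 le2 by (intro mult_mono) auto
  then have "2 * norm (b - c) * norm ?w
      \<le> 2 * norm (b - c) * (sqrt (1 + (norm (b * ?w))\<^sup>2) * sqrt (1 + (norm (c * ?w))\<^sup>2))"
    by (intro mult_left_mono) auto
  moreover have "dist (b * ?w) (c * ?w) = norm (b - c) * norm ?w"
    by (simp add: dist_norm flip: norm_mult left_diff_distrib)
  moreover have "0 < sqrt (1 + (norm (b * ?w))\<^sup>2) * sqrt (1 + (norm (c * ?w))\<^sup>2)"
    using pos by (simp add: add_pos_nonneg)
  ultimately have "dist (stereo (b * ?w)) (stereo (c * ?w)) \<le> 2 * norm (b - c)"
    unfolding dist_stereo by (subst pos_divide_le_eq) simp_all
  then show ?thesis
    using False assms by (simp add: to_sphere_def rot_stereo)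
qed

text \<open>
  In the limit, factors whose moduli tend to 1 only rotate the sphere and the plane. This
  makes both the choice of the determinations of the powers and small relative errors
  in \<open>h\<close> harmless.
\<close>
lemma spherical_limit_change_of_phase:
  assumes lim: "spherical_limit s F" and cont: "continuous_on UNIV F"
    and b: "b \<longlonglongrightarrow> c" and c: "norm c = 1" and d: "d \<longlonglongrightarrow> e" and e: "norm e = 1"
  shows "spherical_limit (\<lambda>n z. b n * s n (d n * z)) (\<lambda>z. rot c (F (e * z)))"
  unfolding spherical_limit_def
proof (intro allI impI)
  fix K :: "complex set"
  assume "compact K"
  then obtain B where B: "B > 0" "\<And>z. z \<in> K \<Longrightarrow> norm z \<le> B"
    using compact_imp_bounded bounded_pos by metis
  let ?L = "cball 0 (2 * B) :: complex set"
  show "uniform_limit K (\<lambda>n. to_sphere (\<lambda>z. b n * s n (d n * z))) (\<lambda>z. rot c (F (e * z))) sequentially"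
  proof (rule uniform_limitI)
    fix \<epsilon> :: real
    assume \<epsilon>: "\<epsilon> > 0"
    have "uniformly_continuous_on ?L F"
      by (intro compact_uniformly_continuous continuous_on_subset[OF cont]) auto
    then obtain \<delta> where \<delta>: "\<delta> > 0"
        "\<And>x y. x \<in> ?L \<Longrightarrow> y \<in> ?L \<Longrightarrow> dist x y < \<delta> \<Longrightarrow> dist (F x) (F y) < \<epsilon> / 3"
      using \<epsilon> unfolding uniformly_continuous_on_def by (metis dist_commute divide_pos_pos zero_less_numeral)
    have "uniform_limit ?L (\<lambda>n. to_sphere (s n)) F sequentially"
      using lim by (simp add: spherical_limit_def)
    then have ev1: "\<forall>\<^sub>F n in sequentially. \<forall>x\<in>?L. dist (to_sphere (s n) x) (F x) < \<epsilon> / 3"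
      using \<epsilon> by (intro uniform_limitD) auto
    have ev2: "\<forall>\<^sub>F n in sequentially. dist (b n) c < min 1 (\<epsilon> / 6)"
      using \<epsilon> by (intro tendstoD[OF b]) auto
    have ev3: "\<forall>\<^sub>F n in sequentially. dist (d n) e < min 1 (\<delta> / B)"
      using \<delta> B by (intro tendstoD[OF d]) auto
    show "\<forall>\<^sub>F n in sequentially. \<forall>z\<in>K. dist (to_sphere (\<lambda>z. b n * s n (d n * z)) z) (rot c (F (e * z))) < \<epsilon>"
      using ev1 ev2 ev3
    proof eventually_elim
      case (elim n)
      have b0: "b n \<noteq> 0" and d0: "d n \<noteq> 0"
        using elim c e by (auto simp: dist_norm)
      have "norm (d n) \<le> 2"
        using elim norm_triangle_ineq2[of "d n" e] e by (simp add: dist_norm)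
      show ?case
      proof
        fix z assume z: "z \<in> K"
        let ?x = "d n * z" and ?y = "e * z"
        have x: "?x \<in> ?L"
          using B(2)[OF z] \<open>norm (d n) \<le> 2\<close> by (auto simp: norm_mult intro: mult_mono)
        have y: "?y \<in> ?L"
          using B(2)[OF z] B(1) e by (simp add: norm_mult)
        have "dist ?x ?y = dist (d n) e * norm z"
          by (simp add: dist_norm flip: norm_mult left_diff_distrib)
        also have "\<dots> \<le> dist (d n) e * B"
          using B(2)[OF z] by (intro mult_left_mono) auto
        also have "\<dots> < \<delta>" using elim B by (simp add: field_simps)
        finally have xy: "dist (F ?x) (F ?y) < \<epsilon> / 3" by (intro \<delta> x y)
        have ts: "to_sphere (\<lambda>z. s n (d n * z)) z = to_sphere (s n) ?x"
          using to_sphere_affine[of "d n" "s n" 0 z] d0 by simp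
        have "dist (to_sphere (\<lambda>z. b n * s n (d n * z)) z) (rot c (to_sphere (s n) ?x)) \<le> 2 * norm (b n - c)"
          using dist_to_sphere_cmult[OF c b0, of "\<lambda>z. s n (d n * z)" z] unfolding ts .
        also have "\<dots> < \<epsilon> / 3" using elim by (simp add: dist_norm)
        finally have 1: "dist (to_sphere (\<lambda>z. b n * s n (d n * z)) z) (rot c (to_sphere (s n) ?x)) < \<epsilon> / 3" .
        have 2: "dist (rot c (to_sphere (s n) ?x)) (rot c (F ?x)) < \<epsilon> / 3"
          using elim x by (simp add: dist_rot[OF c])
        have 3: "dist (rot c (F ?x)) (rot c (F ?y)) < \<epsilon> / 3"
          using xy by (simp add: dist_rot[OF c])
        show "dist (to_sphere (\<lambda>z. b n * s n (d n * z)) z) (rot c (F ?y)) < \<epsilon>"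
          using dist_triangle[of "to_sphere (\<lambda>z. b n * s n (d n * z)) z" "rot c (F ?y)" "rot c (to_sphere (s n) ?x)"]
            dist_triangle[of "rot c (to_sphere (s n) ?x)" "rot c (F ?y)" "rot c (F ?x)"] 1 2 3
          by linarith
      qed
    qed
  qed
qed

lemma spherical_limit_subseq:
  assumes "spherical_limit s F" "strict_mono (r :: nat \<Rightarrow> nat)"
  shows "spherical_limit (s \<circ> r) F"
  unfolding spherical_limit_def
proof (intro allI impI)
  fix K :: "complex set"
  assume "compact K"
  then have "uniform_limit K (\<lambda>n. to_sphere (s n)) F sequentially"
    using assms by (simp add: spherical_limit_def)
  from filterlim_compose[OF this filterlim_subseq[OF assms(2)]]
  show "uniform_limit K (\<lambda>n. to_sphere ((s \<circ> r) n)) F sequentially" by simp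
qed

lemma spherical_limit_pointwise:
  assumes "spherical_limit s F"
  shows "(\<lambda>n. to_sphere (s n) z) \<longlonglongrightarrow> F z"
  using assms[unfolded spherical_limit_def, rule_format, of "{z}"] by simp

section \<open>Sequences with a nonconstant limit function\<close>

text \<open>
  Required of every sequence in a family, this single property yields both normality and, by
  uniqueness of limits (\<open>has_nonconstant_limitD\<close>), the absence of constant limits.
\<close>
definition has_nonconstant_limit :: "(nat \<Rightarrow> complex \<Rightarrow> complex) \<Rightarrow> bool" where
  "has_nonconstant_limit s \<longleftrightarrow>
     (\<exists>r F. strict_mono (r :: nat \<Rightarrow> nat) \<and> spherical_limit (s \<circ> r) F \<and> \<not> F constant_on UNIV)"

lemma has_nonconstant_limitD:
  assumes "has_nonconstant_limit s" "spherical_limit s F"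
  shows "\<not> F constant_on UNIV"
proof -
  obtain r G where r: "strict_mono (r :: nat \<Rightarrow> nat)" "spherical_limit (s \<circ> r) G" "\<not> G constant_on UNIV"
    using assms(1) by (auto simp: has_nonconstant_limit_def)
  have "F = G"
    using LIMSEQ_unique[OF spherical_limit_pointwise[OF spherical_limit_subseq[OF assms(2) r(1)]]
        spherical_limit_pointwise[OF r(2)]] by blast
  then show ?thesis using r(3) by simp
qed

text \<open>
  The error bound is required on the disc of radius \<open>m\<close> only; these discs exhaust the plane.
\<close>
lemma has_nonconstant_limit_close:
  assumes s: "has_nonconstant_limit s"
    and close: "\<And>m z. norm z \<le> real m \<Longrightarrow>
      dist (to_sphere (t m) z) (to_sphere (s m) z) \<le> inverse (real (Suc m))"
  shows "has_nonconstant_limit t"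
proof -
  obtain r F where r: "strict_mono (r :: nat \<Rightarrow> nat)" "spherical_limit (s \<circ> r) F" "\<not> F constant_on UNIV"
    using s by (auto simp: has_nonconstant_limit_def)
  have "spherical_limit (t \<circ> r) F"
    unfolding spherical_limit_def
  proof (intro allI impI)
    fix K :: "complex set"
    assume K: "compact K"
    then obtain B where B: "\<And>z. z \<in> K \<Longrightarrow> norm z \<le> B"
      using compact_imp_bounded bounded_iff by metis
    show "uniform_limit K (\<lambda>n. to_sphere ((t \<circ> r) n)) F sequentially"
    proof (rule uniform_limitI)
      fix \<epsilon> :: real
      assume \<epsilon>: "\<epsilon> > 0"
      have r_top: "filterlim r at_top sequentially" using r(1) by (rule filterlim_subseq)
      have "((\<lambda>n. inverse (real (Suc (r n)))) \<longlongrightarrow> 0) sequentially"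
        by (rule filterlim_compose[OF LIMSEQ_inverse_real_of_nat r_top])
      then have ev1: "\<forall>\<^sub>F n in sequentially. inverse (real (Suc (r n))) < \<epsilon> / 2"
        using \<epsilon> by (intro order_tendstoD) auto
      have ev2: "\<forall>\<^sub>F n in sequentially. B \<le> real (r n)"
        using filterlim_compose[OF filterlim_real_sequentially r_top] by (simp add: filterlim_at_top)
      have ev3: "\<forall>\<^sub>F n in sequentially. \<forall>z\<in>K. dist (to_sphere ((s \<circ> r) n) z) (F z) < \<epsilon> / 2"
        using r(2) K \<epsilon> by (intro uniform_limitD) (auto simp: spherical_limit_def)
      show "\<forall>\<^sub>F n in sequentially. \<forall>z\<in>K. dist (to_sphere ((t \<circ> r) n) z) (F z) < \<epsilon>"
        using ev1 ev2 ev3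
      proof eventually_elim
        case (elim n)
        show ?case
        proof
          fix z assume z: "z \<in> K"
          have "dist (to_sphere (t (r n)) z) (to_sphere (s (r n)) z) < \<epsilon> / 2"
            using close[of z "r n"] B[OF z] elim by force
          moreover have "dist (to_sphere (s (r n)) z) (F z) < \<epsilon> / 2" using elim z by simp
          ultimately show "dist (to_sphere ((t \<circ> r) n) z) (F z) < \<epsilon>"
            using dist_triangle_half_r[of "to_sphere (s (r n)) z"] by (simp add: dist_commute)
        qed
      qed
    qed
  qed
  then show ?thesis using r by (auto simp: has_nonconstant_limit_def)
qed

lemma norm_power_determination:
  assumes "power_determination a p" "h \<noteq> 0"
  shows "norm (p h) = norm h powr a"
proof -
  obtain l where "exp l = h" "p h = exp (of_real a * l)"
    using assms by (auto simp: power_determination_def)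
  then show ?thesis by (auto simp: powr_def)
qed

text \<open>
  The factors \<open>P n\<close> and \<open>Q n\<close> need to have only asymptotically the moduli of \<open>h n powr - \<alpha>\<close> and
  \<open>h n powr - \<beta>\<close>. They differ from the factors used in the definition of the class by \<open>b n\<close> and
  \<open>d n\<close>, whose moduli tend to 1; along a subsequence \<open>b\<close> and \<open>d\<close> converge to unimodular
  numbers, and the limit is a limit function of the class up to rotations.
\<close>
lemma Yosida_class_rescalings:
  assumes f: "f \<in> Yosida_class \<alpha> \<beta>" and h: "filterlim h at_infinity sequentially"
    and P: "(\<lambda>n. norm (P n) * norm (h n) powr \<alpha>) \<longlonglongrightarrow> 1"
    and Q: "(\<lambda>n. norm (Q n) * norm (h n) powr \<beta>) \<longlonglongrightarrow> 1"
  shows "has_nonconstant_limit (\<lambda>n z. P n * f (h n + Q n * z))"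
proof -
  from f obtain p q where f_mero: "f nicely_meromorphic_on UNIV"
    and p: "power_determination (- \<alpha>) p" and q: "power_determination (- \<beta>) q"
    and normal: "normal_family {rescale p q f h | h. norm h \<ge> 1}"
    and nc: "\<And>h F. filterlim h at_infinity sequentially \<Longrightarrow>
        spherical_limit (\<lambda>n. rescale p q f (h n)) F \<Longrightarrow> \<not> F constant_on UNIV"
    by (auto simp: Yosida_class_def transcendental_meromorphic_def)
  have "\<forall>\<^sub>F n in sequentially. 1 \<le> norm (h n)"
    using h filterlim_at_infinity[of 0 h sequentially] by simp
  then obtain N where N: "\<And>n. n \<ge> N \<Longrightarrow> 1 \<le> norm (h n)"
    by (auto simp: eventually_sequentially)
  \<comment> \<open>Normality is available only for \<open>norm h \<ge> 1\<close>, so the first \<open>N\<close> terms are dropped.\<close>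
  define k where "k n = h (n + N)" for n
  have k1: "1 \<le> norm (k n)" for n using N by (simp add: k_def)
  then have k0: "k n \<noteq> 0" for n by (metis norm_zero not_one_le_zero)
  have p0: "p (k n) \<noteq> 0" and q0: "q (k n) \<noteq> 0" for n
    using norm_power_determination[OF p k0[of n]] norm_power_determination[OF q k0[of n]] k0[of n] 
    by auto
  have "range (\<lambda>n. rescale p q f (k n)) \<subseteq> {rescale p q f h | h. norm h \<ge> 1}"
    using k1 by auto
  then obtain r0 F where r0: "strict_mono (r0 :: nat \<Rightarrow> nat)"
    and F: "spherical_limit ((\<lambda>n. rescale p q f (k n)) \<circ> r0) F"
    using normal unfolding normal_family_def by blast
  define b where "b n = P (n + N) / p (k n)" for n
  define d where "d n = Q (n + N) / q (k n)" for n
  have "norm (b n) = norm (P (n + N)) * norm (h (n + N)) powr \<alpha>" for n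
    using k0[of n] by (simp add: b_def norm_divide norm_power_determination[OF p] powr_minus_divide k_def)
  then have b_lim: "(\<lambda>n. norm (b n)) \<longlonglongrightarrow> 1"
    using LIMSEQ_ignore_initial_segment[OF P, of N] by simp
  have "norm (d n) = norm (Q (n + N)) * norm (h (n + N)) powr \<beta>" for n
    using k0[of n] by (simp add: d_def norm_divide norm_power_determination[OF q] powr_minus_divide k_def)
  then have d_lim: "(\<lambda>n. norm (d n)) \<longlonglongrightarrow> 1"
    using LIMSEQ_ignore_initial_segment[OF Q, of N] by simp
  have "bounded (range b)" "bounded (range d)"
    using convergent_imp_Bseq[OF convergentI[OF b_lim]] convergent_imp_Bseq[OF convergentI[OF d_lim]]
    by (auto simp: Bseq_def bounded_iff)
  then have "bounded (range b \<times> range d)" by (rule bounded_Times)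
  then have "bounded (range (\<lambda>n. (b (r0 n), d (r0 n))))"
    by (rule bounded_subset) auto
  then obtain ce r1 where r1: "strict_mono (r1 :: nat \<Rightarrow> nat)"
    and ce: "((\<lambda>n. (b (r0 n), d (r0 n))) \<circ> r1) \<longlonglongrightarrow> ce"
    using bounded_imp_convergent_subsequence by blast
  obtain c e where ce_eq: "ce = (c, e)" by fastforce
  have b: "(\<lambda>n. b (r0 (r1 n))) \<longlonglongrightarrow> c" and d: "(\<lambda>n. d (r0 (r1 n))) \<longlonglongrightarrow> e"
    using tendsto_fst[OF ce] tendsto_snd[OF ce] by (simp_all add: ce_eq o_def)
  have r01: "strict_mono (\<lambda>n. r0 (r1 n))"
    using strict_mono_o[OF r0 r1] by (simp add: o_def)
  have c: "norm c = 1" and e: "norm e = 1"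
    using LIMSEQ_unique[OF tendsto_norm[OF b] LIMSEQ_subseq_LIMSEQ[OF b_lim r01, unfolded o_def]]
      LIMSEQ_unique[OF tendsto_norm[OF d] LIMSEQ_subseq_LIMSEQ[OF d_lim r01, unfolded o_def]] .
  define w where "w n = rescale p q f (k (r0 (r1 n)))" for n
  have w: "spherical_limit w F"
    using spherical_limit_subseq[OF F r1] by (simp add: w_def[abs_def] o_def)
  have "w n nicely_meromorphic_on UNIV" for n
    unfolding w_def rescale_def by (intro nicely_meromorphic_affine f_mero p0 q0)
  then have "sphere_hol F" by (intro sphere_hol_limit[OF _ w]) auto
  then have cont: "continuous_on UNIV F" by (simp add: sphere_hol_def hol_off_north_def)
  define R where "R n = r0 (r1 n) + N" for n
  have R: "strict_mono R"
    using r01 by (simp add: R_def[abs_def] strict_mono_def)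
  have "filterlim (\<lambda>n. h (R n)) at_infinity sequentially"
    by (rule filterlim_compose[OF h filterlim_subseq[OF R]])
  moreover have "w = (\<lambda>n. rescale p q f (h (R n)))"
    by (simp add: w_def[abs_def] k_def R_def)
  ultimately have F_nc: "\<not> F constant_on UNIV" using nc w by metis
  have "(\<lambda>n z. P n * f (h n + Q n * z)) \<circ> R = (\<lambda>n z. b (r0 (r1 n)) * w n (d (r0 (r1 n)) * z))"
    using p0 q0 by (auto simp: fun_eq_iff R_def w_def b_def d_def rescale_def simp flip: k_def)
  then have "spherical_limit ((\<lambda>n z. P n * f (h n + Q n * z)) \<circ> R) (\<lambda>z. rot c (F (e * z)))"
    using spherical_limit_change_of_phase[OF w cont b c d e] by simp
  moreover have "\<not> (\<lambda>z. rot c (F (e * z))) constant_on UNIV"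
  proof
    assume "(\<lambda>z. rot c (F (e * z))) constant_on UNIV"
    then obtain x where x: "rot c (F (e * z)) = x" for z by (auto simp: constant_on_def)
    have "e \<noteq> 0" using e by auto
    have "dist (F z) (F 0) = 0" for z
      using x[of "z / e"] x[of 0] \<open>e \<noteq> 0\<close> dist_rot[OF c, of "F z" "F 0"] by simp
    then show False using F_nc by (metis constant_on_def dist_eq_0_iff)
  qed
  ultimately show ?thesis using R by (auto simp: has_nonconstant_limit_def)
qed

section \<open>Functions whose translates have nonconstant limits\<close>

text \<open>
  If \<open>g\<close> oscillated by \<open>\<epsilon>\<close> between points \<open>x n\<close> and \<open>y n\<close> that approach each other, then a limit of the
  translates by \<open>x n\<close> would be discontinuous at 0.
\<close>
lemma uniformly_continuous_to_sphere:
  assumes g: "g nicely_meromorphic_on UNIV"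
    and trans: "\<And>k. has_nonconstant_limit (\<lambda>n z. g (z + k n))"
  shows "uniformly_continuous_on UNIV (to_sphere g)"
proof (rule ccontr)
  have shift: "to_sphere (\<lambda>z. g (z + c)) z = to_sphere g (z + c)" for c z
    using to_sphere_affine[of 1 g c z] by (simp add: add.commute)
  assume "\<not> uniformly_continuous_on UNIV (to_sphere g)"
  then obtain \<epsilon> where \<epsilon>: "\<epsilon> > 0"
    and bad: "\<And>\<delta>. \<delta> > 0 \<Longrightarrow> \<exists>x y. dist y x < \<delta> \<and> \<not> dist (to_sphere g y) (to_sphere g x) < \<epsilon>"
    unfolding uniformly_continuous_on_def by auto
  have "\<exists>x y. dist y x < inverse (real (Suc n)) \<and> \<not> dist (to_sphere g y) (to_sphere g x) < \<epsilon>" for n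
    by (rule bad) simp
  then obtain x y where xy: "\<And>n. dist (y n) (x n) < inverse (real (Suc n))"
      "\<And>n. \<not> dist (to_sphere g (y n)) (to_sphere g (x n)) < \<epsilon>"
    by metis
  obtain r F where r: "strict_mono (r :: nat \<Rightarrow> nat)" 
    and F: "spherical_limit ((\<lambda>n z. g (z + x n)) \<circ> r) F"
    using trans[of x] by (auto simp: has_nonconstant_limit_def)
  have "(\<lambda>z. g (z + c)) nicely_meromorphic_on UNIV" for c
    using nicely_meromorphic_affine[OF g, of 1 1 c] by (simp add: add.commute)
  then have "sphere_hol F" by (intro sphere_hol_limit[OF _ F]) simp
  then have F_cont: "isCont F 0"
    by (simp add: sphere_hol_def hol_off_north_def continuous_on_eq_continuous_at)
  define w where "w n = y (r n) - x (r n)" for n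
  have w1: "norm (w n) < inverse (real (Suc (r n)))" for n
    using xy(1)[of "r n"] by (simp add: w_def dist_norm)
  have "(\<lambda>n. inverse (real (Suc (r n)))) \<longlonglongrightarrow> 0"
    by (rule filterlim_compose[OF LIMSEQ_inverse_real_of_nat filterlim_subseq[OF r]])
  then have w0: "w \<longlonglongrightarrow> 0"
    by (rule Lim_null_comparison[rotated]) (use w1 in \<open>auto intro!: always_eventually less_imp_le\<close>)
  have "inverse (real (Suc (r n))) \<le> 1" for n by (simp add: inverse_le_1_iff)
  then have w_cball: "w n \<in> cball 0 1" for n
    using w1[of n] by (smt (verit) mem_cball_0)
  have "(\<lambda>n. F (w n)) \<longlonglongrightarrow> F 0" using F_cont w0 isCont_tendsto_compose by blast
  then have ev1: "\<forall>\<^sub>F n in sequentially. dist (F (w n)) (F 0) < \<epsilon> / 3"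
    using \<epsilon> by (intro tendstoD) auto
  have ev2: "\<forall>\<^sub>F n in sequentially. \<forall>z\<in>cball 0 1. 
      dist (to_sphere (((\<lambda>n z. g (z + x n)) \<circ> r) n) z) (F z) < \<epsilon> / 3"
    using F \<epsilon> by (intro uniform_limitD) (auto simp: spherical_limit_def)
  have "\<forall>\<^sub>F n in sequentially. False"
    using ev1 ev2
  proof eventually_elim
    case (elim n)
    have "dist (to_sphere g (w n + x (r n))) (F (w n)) < \<epsilon> / 3"
      using elim(2) w_cball[of n] by (simp add: shift)
    moreover have "dist (to_sphere g (0 + x (r n))) (F 0) < \<epsilon> / 3"
      using elim(2)[rule_format, of 0] by (simp only: o_def shift mem_cball dist_self zero_le_one)
    moreover have "w n + x (r n) = y (r n)" by (simp add: w_def)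
    ultimately have "dist (to_sphere g (y (r n))) (to_sphere g (x (r n))) < \<epsilon>"
      using elim(1) dist_triangle[of "to_sphere g (y (r n))" "to_sphere g (x (r n))" "F (w n)"]
        dist_triangle[of "F (w n)" "to_sphere g (x (r n))" "F 0"]
        dist_commute[of "to_sphere g (x (r n))" "F 0"] by simp
    then show ?case using xy(2) by blast
  qed
  then show False by simp
qed

text \<open>
  A map that starts in the southern hemisphere and oscillates by at most 1/2 stays at heights at
  most 1/2, where the chart is bounded by \<open>sqrt 3 \<le> 2\<close>; Cauchy's estimate does the rest.
\<close>
lemma norm_deriv_chart_le:
  assumes G: "hol_off_north G" and \<rho>: "\<rho> > 0" and z: "snd (G z) \<le> 0"
    and close: "\<And>w. w \<in> cball z \<rho> \<Longrightarrow> dist (G w) (G z) \<le> 1 / 2"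
  shows "norm (deriv (\<lambda>w. chart (G w)) z) \<le> 2 / \<rho>"
proof -
  have half: "snd (G w) \<le> 1 / 2" if "w \<in> cball z \<rho>" for w
  proof -
    have "\<bar>snd (G w) - snd (G z)\<bar> \<le> dist (G w) (G z)"
      by (metis dist_real_def dist_snd_le)
    then show ?thesis using close[OF that] z by linarith
  qed
  have norm: "norm (G w) = 1" for w using G by (simp add: hol_off_north_def)
  have ne: "G w \<noteq> (0, 1)" if "w \<in> cball z \<rho>" for w
    using half[OF that] by auto
  have bound: "norm (chart (G w)) \<le> 2" if "w \<in> cball z \<rho>" for w
  proof (rule power2_le_imp_le)
    show "(norm (chart (G w)))\<^sup>2 \<le> 2\<^sup>2"
      unfolding norm_chart_sq[OF norm ne[OF that]] using half[OF that] by (simp add: divide_le_eq)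
  qed simp
  have "(\<lambda>w. chart (G w)) analytic_on cball z \<rho>"
    using G ne by (subst analytic_on_analytic_at) (auto simp: hol_off_north_def)
  then have hol: "(\<lambda>w. chart (G w)) holomorphic_on cball z \<rho>"
    by (rule analytic_imp_holomorphic)
  have "norm ((deriv ^^ 1) (\<lambda>w. chart (G w)) z) \<le> fact 1 * 2 / \<rho> ^ 1"
  proof (rule Cauchy_inequality)
    show "(\<lambda>w. chart (G w)) holomorphic_on ball z \<rho>"
      using hol ball_subset_cball by (rule holomorphic_on_subset)
    show "continuous_on (cball z \<rho>) (\<lambda>w. chart (G w))"
      using hol by (rule holomorphic_on_imp_continuous_on)
    show "norm (chart (G w)) \<le> 2" if "norm (z - w) = \<rho>" for w
      using that by (intro bound) (simp add: dist_norm)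
  qed (rule \<rho>)
  then show ?thesis by simp
qed

text \<open>
  The spherical derivative is bounded by the ordinary derivative of \<open>g\<close> and by that of \<open>1 / g\<close>;
  one of the two functions starts in the unit disc, according to the hemisphere.
\<close>
lemma bounded_spherical_deriv:
  assumes g: "g nicely_meromorphic_on UNIV" and uc: "uniformly_continuous_on UNIV (to_sphere g)"
  shows "bounded (range (spherical_deriv g))"
proof -
  obtain \<delta> where \<delta>: "\<delta> > 0" "\<And>x y. dist x y < \<delta> \<Longrightarrow> dist (to_sphere g x) (to_sphere g y) < 1 / 2"
    using uc unfolding uniformly_continuous_on_def by (metis UNIV_I half_gt_zero_iff zero_less_one)
  define \<rho> where "\<rho> = \<delta> / 2"
  have \<rho>: "\<rho> > 0" using \<delta> by (simp add: \<rho>_def)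
  have close: "dist (to_sphere g w) (to_sphere g z) \<le> 1 / 2" if "w \<in> cball z \<rho>" for w z
    using that \<delta> by (intro less_imp_le) (auto simp: \<rho>_def dist_commute)
  have hol: "hol_off_north (to_sphere g)" "hol_off_north (\<lambda>z. flip (to_sphere g z))"
    using sphere_hol_to_sphere[OF g] by (auto simp: sphere_hol_def)
  have "spherical_deriv g z \<le> 2 / \<rho>" for z
  proof (cases "snd (to_sphere g z) \<le> 0")
    case True
    then have "\<not> is_pole g z" by (auto simp: to_sphere_def)
    then have "spherical_deriv g z = norm (deriv g z) / (1 + (norm (g z))\<^sup>2)"
      by (simp add: spherical_deriv_def)
    also have "\<dots> \<le> norm (deriv g z) / 1"
      by (intro divide_left_mono) (auto simp: add_pos_nonneg)
    also have "\<dots> \<le> 2 / \<rho>"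
      using norm_deriv_chart_le[OF hol(1) \<rho> True close] by (simp add: chart_to_sphere[OF g])
    finally show ?thesis .
  next
    case False
    have "snd (flip (to_sphere g z)) \<le> 0" using False by (simp add: flip_def)
    from norm_deriv_chart_le[OF hol(2) \<rho> this] close
    have bound: "norm (deriv (\<lambda>w. inverse (g w)) z) \<le> 2 / \<rho>"
      by (simp add: chart_flip_to_sphere[OF g])
    show ?thesis
    proof (cases "is_pole g z")
      case True
      then show ?thesis using bound by (simp add: spherical_deriv_def)
    next
      case np: False
      then have g0: "g z \<noteq> 0" using False by (auto simp: to_sphere_def stereo_def)
      have "g analytic_on {z}" using g np nicely_meromorphic_on_imp_analytic_at by blast
      then have "(g has_field_derivative deriv g z) (at z)"
        using analytic_on_imp_differentiable_at DERIV_deriv_iff_field_differentiable by blast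
      from DERIV_imp_deriv[OF DERIV_inverse_fun[OF this g0]]
      have "norm (deriv (\<lambda>w. inverse (g w)) z) = norm (deriv g z) / (norm (g z))\<^sup>2"
        by (simp add: norm_mult norm_inverse power2_eq_square divide_inverse mult_ac)
      moreover have "norm (deriv g z) / (1 + (norm (g z))\<^sup>2) \<le> norm (deriv g z) / (norm (g z))\<^sup>2"
        using g0 by (intro divide_left_mono mult_pos_pos) (auto simp: add_pos_nonneg)
      ultimately show ?thesis using bound np by (simp add: spherical_deriv_def)
    qed
  qed
  moreover have "0 \<le> spherical_deriv g z" for z
    by (simp add: spherical_deriv_def)
  ultimately show ?thesis unfolding bounded_iff by (intro exI[of _ "2 / \<rho>"]) auto
qed

text \<open>
  Polynomial division writes the function as a polynomial plus a remainder that vanishes at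
  infinity.
\<close>
lemma rational_to_sphere_tendsto:
  assumes Q: "Q \<noteq> 0" and g: "\<And>z. poly Q z \<noteq> 0 \<Longrightarrow> g z = poly P z / poly Q z"
  shows "\<exists>x. (to_sphere g \<longlongrightarrow> x) at_infinity"
proof -
  define A where "A = {z. poly Q z \<noteq> 0}"
  have "open A"
    unfolding A_def by (intro open_Collect_neq continuous_intros)
  have "(\<lambda>z. poly P z / poly Q z) holomorphic_on A"
    by (intro holomorphic_intros) (auto simp: A_def)
  then have "g holomorphic_on A"
    by (rule holomorphic_transform) (auto simp: A_def g)
  then have np: "\<not> is_pole g z" if "z \<in> A" for z
    using not_is_pole_holomorphic \<open>open A\<close> that by blast
  have "\<forall>\<^sub>F z in at_infinity. \<forall>a\<in>{a. poly Q a = 0}. z \<noteq> a"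
    using poly_roots_finite[OF Q] eventually_not_equal_at_infinity
    by (intro eventually_ball_finite) auto
  then have ev: "\<forall>\<^sub>F z in at_infinity. z \<in> A"
    by eventually_elim (auto simp: A_def)
  define D R where "D = P div Q" and "R = P mod Q"
  have R_lim: "((\<lambda>z. poly R z / poly Q z) \<longlongrightarrow> 0) at_infinity"
  proof (cases "R = 0")
    case False
    then have "degree R < degree Q" using degree_mod_less[OF Q, of P] by (simp add: R_def)
    then show ?thesis by (rule poly_divide_tendsto_0_at_infinity)
  qed simp
  have "poly P z = poly D z * poly Q z + poly R z" for z
    unfolding D_def R_def by (metis div_mult_mod_eq poly_add poly_mult)
  then have ts: "to_sphere g z = stereo (poly R z / poly Q z + poly D z)" if "z \<in> A" for z
    using that np[OF that] g[of z] by (simp add: to_sphere_def A_def add_divide_distrib add.commute)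
  have ev_ts: "\<forall>\<^sub>F z in at_infinity. stereo (poly R z / poly Q z + poly D z) = to_sphere g z"
    using ev by eventually_elim (simp add: ts)
  have "\<exists>x. ((\<lambda>z. stereo (poly R z / poly Q z + poly D z)) \<longlongrightarrow> x) at_infinity"
  proof (cases "degree D = 0")
    case True
    then obtain c where "D = [:c:]" by (rule degree_eq_zeroE)
    then have "((\<lambda>z. poly R z / poly Q z + poly D z) \<longlongrightarrow> 0 + c) at_infinity"
      by (intro tendsto_add R_lim) simp
    from isCont_tendsto_compose[OF isCont_stereo this] show ?thesis by blast
  next
    case False
    then have "filterlim (\<lambda>z. poly R z / poly Q z + poly D z) at_infinity at_infinity"
      by (intro tendsto_add_filterlim_at_infinity[OF R_lim] filterlim_poly_at_infinity) simp
    from filterlim_compose[OF stereo_at_infinity this] show ?thesis by blast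
  qed
  then show ?thesis using tendsto_cong[OF ev_ts] by blast
qed

text \<open>
  Transcendence comes from the nonconstant limits as well: a rational function has a value at
  infinity, so its translates by \<open>0, 1, 2, \<dots>\<close> converge to a constant. For both exponents 0 the
  rescalings are just the translates, with the constant 1 as a determination of \<open>h powr 0\<close>.
\<close>
lemma translates_imp_Yosida:
  assumes g: "g nicely_meromorphic_on UNIV"
    and trans: "\<And>k. has_nonconstant_limit (\<lambda>n z. g (z + k n))"
  shows "g \<in> Yosida_A0" "g \<in> Yosida_class 0 0"
proof -
  have shift: "to_sphere (\<lambda>z. g (z + c)) z = to_sphere g (z + c)" for c z
    using to_sphere_affine[of 1 g c z] by (simp add: add.commute)
  have transc: "transcendental_meromorphic g"
  proof (rule ccontr)
    assume "\<not> transcendental_meromorphic g"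
    then obtain P Q where "Q \<noteq> 0" "\<And>z. poly Q z \<noteq> 0 \<Longrightarrow> g z = poly P z / poly Q z"
      using g by (auto simp: transcendental_meromorphic_def)
    then obtain x where x: "(to_sphere g \<longlongrightarrow> x) at_infinity"
      using rational_to_sphere_tendsto by blast
    obtain r F where r: "strict_mono (r :: nat \<Rightarrow> nat)" 
      and F: "spherical_limit ((\<lambda>n z. g (z + of_nat n)) \<circ> r) F" and nc: "\<not> F constant_on UNIV"
      using trans[of of_nat] by (auto simp: has_nonconstant_limit_def)
    have "F z = x" for z
    proof -
      have "filterlim (\<lambda>n. z + of_nat (r n)) at_infinity sequentially"
        by (intro tendsto_add_filterlim_at_infinity[OF tendsto_const]
            filterlim_compose[OF tendsto_of_nat filterlim_subseq[OF r]])
      then have "(\<lambda>n. to_sphere g (z + of_nat (r n))) \<longlonglongrightarrow> x"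
        by (rule filterlim_compose[OF x])
      moreover have "(\<lambda>n. to_sphere g (z + of_nat (r n))) \<longlonglongrightarrow> F z"
        using spherical_limit_pointwise[OF F, of z] by (simp add: o_def shift)
      ultimately show ?thesis using LIMSEQ_unique by blast
    qed
    then show False using nc by (auto simp: constant_on_def)
  qed
  show "g \<in> Yosida_A0"
    using transc bounded_spherical_deriv[OF g uniformly_continuous_to_sphere[OF g trans]]
      has_nonconstant_limitD[OF trans] by (auto simp: Yosida_A0_def)
  have one: "rescale (\<lambda>_. 1) (\<lambda>_. 1) g h = (\<lambda>z. g (z + h))" for h
    by (simp add: rescale_def add.commute)
  have det: "power_determination (- 0) (\<lambda>_. 1)"
    by (auto simp: power_determination_def intro: exp_Ln)
  have "normal_family {rescale (\<lambda>_. 1) (\<lambda>_. 1) g h | h. norm h \<ge> 1}"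
    unfolding normal_family_def
  proof (intro allI impI)
    fix s :: "nat \<Rightarrow> complex \<Rightarrow> complex"
    assume "range s \<subseteq> {rescale (\<lambda>_. 1) (\<lambda>_. 1) g h | h. norm h \<ge> 1}"
    then have "\<exists>h. s n = (\<lambda>z. g (z + h))" for n unfolding one by blast
    then obtain k where "s = (\<lambda>n z. g (z + k n))" by metis
    then show "\<exists>r F. strict_mono (r :: nat \<Rightarrow> nat) \<and> spherical_limit (s \<circ> r) F"
      using trans[of k] by (auto simp: has_nonconstant_limit_def)
  qed
  then show "g \<in> Yosida_class 0 0"
    using transc det has_nonconstant_limitD[OF trans]
    unfolding Yosida_class_def mem_Collect_eq
    by (intro conjI exI[of _ "\<lambda>_. 1"]) (auto simp: one)
qed

section \<open>Translates of a limit function\<close>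

text \<open>
  With \<open>H' = H + q H * k\<close> one has \<open>rescale p q f H (z + k) = p H * f (H' + q H * z)\<close>, so a translate
  of a rescaling is a rescaling about the neighbouring point \<open>H'\<close>. Its factors still belong to
  \<open>H\<close>, but \<open>\<bar>q H\<bar> / \<bar>H\<bar> = \<bar>H\<bar> powr (- \<beta> - 1)\<close> tends to 0 because \<open>\<beta> > -1\<close>, hence \<open>\<bar>H'\<bar> / \<bar>H\<bar>\<close> tends to 1
  and the moduli are asymptotically right. For each \<open>m\<close> the point \<open>H m\<close> is taken so far out in
  the given sequence that the rescaling about it approximates \<open>g\<close> on a disc containing \<open>k m + z\<close>
  for all \<open>norm z \<le> m\<close>.
\<close>
lemma translates_of_limit:
  assumes \<beta>: "\<beta> > -1" and f: "f \<in> Yosida_class \<alpha> \<beta>"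
    and p: "power_determination (- \<alpha>) p" and q: "power_determination (- \<beta>) q"
    and h: "filterlim h at_infinity sequentially"
    and lim: "spherical_limit (\<lambda>n. rescale p q f (h n)) (to_sphere g)"
  shows "has_nonconstant_limit (\<lambda>m z. g (z + k m))"
proof -
  have h_top: "filterlim (\<lambda>n. norm (h n)) at_top sequentially"
    using h by (rule filterlim_at_infinity_imp_norm_at_top)
  have "\<exists>n. real (Suc m) \<le> norm (h n) \<and> norm (q (h n) * k m) \<le> norm (h n) * inverse (real (Suc m)) \<and>
      (\<forall>z\<in>cball 0 (real m + norm (k m)).
        dist (to_sphere (rescale p q f (h n)) z) (to_sphere g z) < inverse (real (Suc m)))" for m
  proof -
    have ev1: "\<forall>\<^sub>F n in sequentially. real (Suc m) \<le> norm (h n)"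
      using h_top by (simp add: filterlim_at_top)
    have "(\<lambda>n. norm (h n) powr (- \<beta> - 1) * norm (k m)) \<longlonglongrightarrow> 0"
      using \<beta> by (intro tendsto_mult_left_zero tendsto_neg_powr h_top) simp
    then have ev2: "\<forall>\<^sub>F n in sequentially. norm (h n) powr (- \<beta> - 1) * norm (k m) < inverse (real (Suc m))"
      by (rule order_tendstoD) simp
    have ev3: "\<forall>\<^sub>F n in sequentially. \<forall>z\<in>cball 0 (real m + norm (k m)).
        dist (to_sphere (rescale p q f (h n)) z) (to_sphere g z) < inverse (real (Suc m))"
      using lim by (intro uniform_limitD) (auto simp: spherical_limit_def)
    have "\<forall>\<^sub>F n in sequentially. real (Suc m) \<le> norm (h n) \<and> 
        norm (q (h n) * k m) \<le> norm (h n) * inverse (real (Suc m)) \<and>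
        (\<forall>z\<in>cball 0 (real m + norm (k m)).
          dist (to_sphere (rescale p q f (h n)) z) (to_sphere g z) < inverse (real (Suc m)))"
      using ev1 ev2 ev3
    proof eventually_elim
      case (elim n)
      have h0: "norm (h n) > 0" using elim(1) by linarith
      have "norm (h n) powr (- \<beta>) = norm (h n) * norm (h n) powr (- \<beta> - 1)"
        using powr_mult_base[of "norm (h n)" "- \<beta> - 1"] by simp
      then have "norm (q (h n) * k m) = norm (h n) * (norm (h n) powr (- \<beta> - 1) * norm (k m))"
        using h0 by (simp add: norm_mult norm_power_determination[OF q])
      also have "\<dots> \<le> norm (h n) * inverse (real (Suc m))"
        using elim(2) by (intro mult_left_mono) auto
      finally show ?case using elim(1,3) by blast
    qed
    then show ?thesis by (rule eventually_happens'[OF sequentially_bot])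
  qed
  then obtain n where n: "\<And>m. real (Suc m) \<le> norm (h (n m))"
      "\<And>m. norm (q (h (n m)) * k m) \<le> norm (h (n m)) * inverse (real (Suc m))"
      "\<And>m z. z \<in> cball 0 (real m + norm (k m)) \<Longrightarrow>
        dist (to_sphere (rescale p q f (h (n m))) z) (to_sphere g z) < inverse (real (Suc m))"
    by metis
  define H where "H m = h (n m)" for m
  define H' where "H' m = H m + q (H m) * k m" for m
  have H_pos: "norm (H m) > 0" for m
    using n(1)[of m] unfolding H_def by linarith
  then have H0: "H m \<noteq> 0" for m using norm_zero less_irrefl by metis
  have diff: "\<bar>norm (H' m) - norm (H m)\<bar> \<le> norm (H m) * inverse (real (Suc m))" for m
    using norm_triangle_ineq3[of "H' m" "H m"] n(2)[of m] by (simp add: H'_def H_def)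
  have H': "filterlim H' at_infinity sequentially"
  proof (rule filterlim_norm_at_top_imp_at_infinity, rule filterlim_at_top_mono[OF filterlim_real_sequentially])
    have "real m \<le> norm (H' m)" for m
    proof -
      have "real m = real (Suc m) * (1 - inverse (real (Suc m)))" by (simp add: field_simps)
      also have "\<dots> \<le> norm (H m) * (1 - inverse (real (Suc m)))"
        using n(1)[of m] by (intro mult_right_mono) (auto simp: H_def inverse_le_1_iff)
      also have "\<dots> \<le> norm (H' m)"
        using diff[of m] by (simp add: right_diff_distrib)
      finally show ?thesis .
    qed
    then show "\<forall>\<^sub>F m in sequentially. real m \<le> norm (H' m)" by simp
  qed
  have ratio: "(\<lambda>m. norm (H' m) / norm (H m)) \<longlonglongrightarrow> 1"
  proof -
    have "\<bar>norm (H' m) / norm (H m) - 1\<bar> \<le> inverse (real (Suc m))" for m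
    proof -
      have "norm (H' m) / norm (H m) - 1 = (norm (H' m) - norm (H m)) / norm (H m)"
        using H_pos[of m] by (simp add: diff_divide_distrib)
      then have "\<bar>norm (H' m) / norm (H m) - 1\<bar> = \<bar>norm (H' m) - norm (H m)\<bar> / norm (H m)"
        by simp
      also have "\<dots> \<le> inverse (real (Suc m))"
        using diff[of m] H_pos[of m] by (simp add: pos_divide_le_eq mult.commute)
      finally show ?thesis .
    qed
    then have "(\<lambda>m. norm (H' m) / norm (H m) - 1) \<longlonglongrightarrow> 0"
      by (intro Lim_null_comparison[OF _ LIMSEQ_inverse_real_of_nat]) simp
    then show ?thesis by (rule LIM_zero_cancel)
  qed
  have factor: "(\<lambda>m. norm (P (H m)) * norm (H' m) powr a) \<longlonglongrightarrow> 1" if "power_determination (- a) P" for P a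
  proof -
    have "norm (P (H m)) * norm (H' m) powr a = (norm (H' m) / norm (H m)) powr a" for m
      using H0[of m] by (simp add: norm_power_determination[OF that] powr_divide powr_minus_divide)
    moreover have "(\<lambda>m. (norm (H' m) / norm (H m)) powr a) \<longlonglongrightarrow> 1 powr a"
      by (intro tendsto_powr ratio tendsto_const) simp
    ultimately show ?thesis by simp
  qed
  show ?thesis
  proof (rule has_nonconstant_limit_close)
    show "has_nonconstant_limit (\<lambda>m z. p (H m) * f (H' m + q (H m) * z))"
      by (rule Yosida_class_rescalings[OF f H' factor[OF p] factor[OF q]])
    fix m :: nat and z :: complex
    assume "norm z \<le> real m"
    then have "z + k m \<in> cball 0 (real m + norm (k m))"
      using norm_triangle_ineq[of z "k m"] by simp
    then have "dist (to_sphere (rescale p q f (H m)) (z + k m)) (to_sphere g (z + k m)) < inverse (real (Suc m))"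
      unfolding H_def by (rule n(3))
    moreover have "to_sphere (\<lambda>z. g (z + k m)) z = to_sphere g (z + k m)"
      using to_sphere_affine[of 1 g "k m" z] by (simp add: add.commute)
    moreover have "(\<lambda>z. p (H m) * f (H' m + q (H m) * z)) = (\<lambda>z. rescale p q f (H m) (k m + 1 * z))"
      by (simp add: rescale_def H'_def distrib_left add.assoc)
    then have "to_sphere (\<lambda>z. p (H m) * f (H' m + q (H m) * z)) z = to_sphere (rescale p q f (H m)) (z + k m)"
      using to_sphere_affine[of 1 "rescale p q f (H m)" "k m" z] by (simp add: add.commute)
    ultimately show "dist (to_sphere (\<lambda>z. g (z + k m)) z)
        (to_sphere (\<lambda>z. p (H m) * f (H' m + q (H m) * z)) z) \<le> inverse (real (Suc m))"
      by (simp add: dist_commute)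
  qed
qed

theorem theorem8:
  fixes \<alpha> \<beta> :: real
    and f p q :: "complex \<Rightarrow> complex"
    and h :: "nat \<Rightarrow> complex"
    and F :: "complex \<Rightarrow> complex \<times> real"
  assumes "\<beta> > -1"
    and "f \<in> Yosida_class \<alpha> \<beta>"
    and "power_determination (- \<alpha>) p"
    and "power_determination (- \<beta>) q"
    and "filterlim h at_infinity sequentially"
    and "spherical_limit (\<lambda>n. rescale p q f (h n)) F"
  shows "\<exists>g. F = to_sphere g \<and> g \<in> Yosida_A0 \<and> g \<in> Yosida_class 0 0"
proof -
  have f_mero: "f nicely_meromorphic_on UNIV"
    using assms(2) by (auto simp: Yosida_class_def transcendental_meromorphic_def)
  have h0: "\<forall>\<^sub>F n in sequentially. h n \<noteq> 0"
    using filterlim_at_infinity_imp_eventually_ne[OF assms(5)] .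
  have factor: "(\<lambda>n. norm (P (h n)) * norm (h n) powr a) \<longlonglongrightarrow> 1" if "power_determination (- a) P" for P a
  proof (rule tendsto_eventually)
    show "\<forall>\<^sub>F n in sequentially. norm (P (h n)) * norm (h n) powr a = 1"
      using h0 by eventually_elim (simp add: norm_power_determination[OF that] powr_minus)
  qed
  have "has_nonconstant_limit (\<lambda>n. rescale p q f (h n))"
    unfolding rescale_def
    by (rule Yosida_class_rescalings[OF assms(2,5) factor[OF assms(3)] factor[OF assms(4)]])
  then have nc: "\<not> F constant_on UNIV" using assms(6) by (rule has_nonconstant_limitD)
  have "\<forall>\<^sub>F n in sequentially. rescale p q f (h n) nicely_meromorphic_on UNIV"
    using h0
  proof eventually_elim
    case (elim n)
    then have "p (h n) \<noteq> 0" "q (h n) \<noteq> 0"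
      using norm_power_determination[OF assms(3) elim] norm_power_determination[OF assms(4) elim] by auto
    then show ?case unfolding rescale_def by (intro nicely_meromorphic_affine f_mero)
  qed
  then have hol: "sphere_hol F" using assms(6) by (rule sphere_hol_limit)
  define g where "g = (\<lambda>z. chart (F z))"
  have g: "g nicely_meromorphic_on UNIV" and F: "F = to_sphere g"
    using nonconstant_sphere_hol_is_meromorphic[OF hol nc] by (simp_all add: g_def)
  have "has_nonconstant_limit (\<lambda>m z. g (z + k m))" for k
    by (rule translates_of_limit[OF assms(1-5)]) (use assms(6) F in simp)
  then show ?thesis using F translates_imp_Yosida[OF g] by blast
qed

end
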